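(* Let $n>2$ be an integer, let $G=\mathrm{Dc}_n$, and let $\varphi_{(r,s)}$, with $r\in\mathcal{U}_{2n}$ and $s\in\mathbb{Z}_{2n}$, be an automorphism of $G$ of order $k$. Let $Q=\{g\varphi_{(r,s)}(g)^{-1}\mid g\in G\}$ and $H=\{g\in G\mid \varphi_{(r,s)}(g)=g\}$. Then $$Q=\{x^{b(1-r)}\mid b\in\mathbb{Z}_{2n}\}\cup\{x^{s+b(r-1)}\mid b\in\mathbb{Z}_{2n}\}$$ and $$H=\{x^b\mid b\in\mathbb{Z}_{2n},\ b(1-r)\equiv 0 \pmod{2n}\}\cup\{yx^b\mid b\in\mathbb{Z}_{2n},\ b(1-r)\equiv s\pmod{2n}\}.$$
   Context: $\mathrm{Dc}_n=\langle x,y \mid x^{2n}=1,\ y^2=x^n,\ y^{-1}xy=x^{-1}\rangle$ is the dicyclic group of order $4n$. $\mathcal{U}_{2n}$ denotes the set of units of $\mathbb{Z}_{2n}$ (integers modulo $2n$). For $n>2$, every automorphism of $\mathrm{Dc}_n$ can be written uniquely as $\varphi_{(r,s)}$ with $r\in\mathcal{U}_{2n}$, $s\in\mathbb{Z}_{2n}$, where $\varphi_{(r,s)}(x)=x^r$ and $\varphi_{(r,s)}(y)=yx^s$. Exponents of $x$ are read modulo $2n$. *)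

theory Defs
  imports "HOL-Algebra.Algebra" "HOL-Number_Theory.Residues"
begin

text \<open>
  Groups given by generators and relations.  A word is a list of letters
  \<open>(a, e)\<close>, where \<open>(a, True)\<close> stands for the generator \<open>a\<close> and \<open>(a, False)\<close> for its
  formal inverse.  A relation \<open>u = v\<close> is a pair of words.
\<close>

type_synonym 'a word = "('a \<times> bool) list"

inductive word_eq :: "('a word \<times> 'a word) set \<Rightarrow> 'a word \<Rightarrow> 'a word \<Rightarrow> bool"
  for R where
  refl: "word_eq R u u"
| sym: "word_eq R u v \<Longrightarrow> word_eq R v u"
| trans: "word_eq R u v \<Longrightarrow> word_eq R v w \<Longrightarrow> word_eq R u w"
| append: "word_eq R u u' \<Longrightarrow> word_eq R v v' \<Longrightarrow> word_eq R (u @ v) (u' @ v')"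
| cancel: "word_eq R [(a, e), (a, \<not> e)] []"
| rel: "(u, v) \<in> R \<Longrightarrow> word_eq R u v"

definition word_class :: "('a word \<times> 'a word) set \<Rightarrow> 'a word \<Rightarrow> 'a word set" where
  "word_class R u = {v. word_eq R u v}"

definition presented_group :: "('a word \<times> 'a word) set \<Rightarrow> 'a word set monoid" where
  "presented_group R =
     \<lparr>carrier = range (word_class R),
      monoid.mult = (\<lambda>A B. \<Union>u\<in>A. \<Union>v\<in>B. word_class R (u @ v)),
      one = word_class R []\<rparr>"

lemma word_class_eq_iff: "word_class R u = word_class R v \<longleftrightarrow> word_eq R u v"
proof
  assume "word_class R u = word_class R v"
  moreover have "v \<in> word_class R v"
    by (simp add: word_class_def word_eq.refl)
  ultimately have "v \<in> word_class R u"
    by (simp only:)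
  then show "word_eq R u v"
    by (simp add: word_class_def)
next
  assume uv: "word_eq R u v"
  have "word_eq R u w \<longleftrightarrow> word_eq R v w" for w
    using word_eq.trans[OF uv, of w] word_eq.trans[OF word_eq.sym[OF uv], of w] by iprover
  then show "word_class R u = word_class R v"
    by (simp add: word_class_def)
qed

lemma word_class_mult:
  "word_class R u \<otimes>\<^bsub>presented_group R\<^esub> word_class R v = word_class R (u @ v)"
proof -
  have eq: "word_class R (u' @ v') = word_class R (u @ v)"
    if "u' \<in> word_class R u" "v' \<in> word_class R v" for u' v'
  proof -
    have "word_eq R u u'" "word_eq R v v'"
      using that by (simp_all add: word_class_def)
    then have "word_eq R (u @ v) (u' @ v')"
      by (rule word_eq.append)
    from word_eq.sym[OF this] show ?thesis
      by (simp only: word_class_eq_iff)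
  qed
  have "u \<in> word_class R u" "v \<in> word_class R v"
    by (simp_all add: word_class_def word_eq.refl)
  then have "(\<Union>u'\<in>word_class R u. \<Union>v'\<in>word_class R v. word_class R (u' @ v'))
      = word_class R (u @ v)"
    using eq by blast
  then show ?thesis
    by (simp add: presented_group_def)
qed

lemma word_eq_inverse: "\<exists>v. word_eq R (v @ u) []"
proof (induction u)
  case Nil
  show ?case by (rule exI[of _ "[]"]) (simp add: word_eq.refl)
next
  case (Cons p u)
  obtain a e where p: "p = (a, e)" by (cases p)
  from Cons obtain v where v: "word_eq R (v @ u) []" ..
  have c: "word_eq R [(a, \<not> e), (a, e)] []"
    using word_eq.cancel[of R a "\<not> e"] by simp
  have "word_eq R (v @ ([(a, \<not> e), (a, e)] @ u)) (v @ ([] @ u))"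
    by (intro word_eq.append c word_eq.refl)
  then have "word_eq R ((v @ [(a, \<not> e)]) @ (p # u)) (v @ u)"
    by (simp add: p)
  from word_eq.trans[OF this v] show ?case ..
qed

lemma carrier_presented_group: "carrier (presented_group R) = range (word_class R)"
  by (simp add: presented_group_def)

lemma one_presented_group: "\<one>\<^bsub>presented_group R\<^esub> = word_class R []"
  by (simp add: presented_group_def)

lemma group_presented_group: "group (presented_group R)"
proof (rule groupI)
  fix A assume "A \<in> carrier (presented_group R)"
  then obtain u where A: "A = word_class R u"
    by (auto simp: carrier_presented_group)
  obtain v where "word_eq R (v @ u) []"
    using word_eq_inverse by blast
  then have "word_class R v \<otimes>\<^bsub>presented_group R\<^esub> A = \<one>\<^bsub>presented_group R\<^esub>"
    by (simp only: A word_class_mult one_presented_group word_class_eq_iff)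
  then show "\<exists>B\<in>carrier (presented_group R). B \<otimes>\<^bsub>presented_group R\<^esub> A = \<one>\<^bsub>presented_group R\<^esub>"
    unfolding carrier_presented_group by blast
qed (auto simp: carrier_presented_group one_presented_group word_class_mult)

datatype dc_gen = gen_x | gen_y

definition dicyclic_rels :: "nat \<Rightarrow> (dc_gen word \<times> dc_gen word) set" where
  "dicyclic_rels n =
     {(replicate (2 * n) (gen_x, True), []),
      (replicate 2 (gen_y, True), replicate n (gen_x, True)),
      ([(gen_y, False), (gen_x, True), (gen_y, True)], [(gen_x, False)])}"

definition Dc :: "nat \<Rightarrow> dc_gen word set monoid" where
  "Dc n = presented_group (dicyclic_rels n)"

definition dc_x :: "nat \<Rightarrow> dc_gen word set" where
  "dc_x n = word_class (dicyclic_rels n) [(gen_x, True)]"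

definition dc_y :: "nat \<Rightarrow> dc_gen word set" where
  "dc_y n = word_class (dicyclic_rels n) [(gen_y, True)]"

text \<open>
  \<open>is_dc_aut n r s \<phi>\<close> says that \<open>\<phi>\<close> is the automorphism of \<open>Dc n\<close> with parameters \<open>(r, s)\<close>.
  It is determined by \<open>r\<close> and \<open>s\<close>, since \<open>dc_x n\<close> and \<open>dc_y n\<close> generate \<open>Dc n\<close> and members of
  \<open>carrier (AutoGroup G)\<close> are extensional on \<open>carrier G\<close>.
\<close>

definition is_dc_aut ::
  "nat \<Rightarrow> int \<Rightarrow> int \<Rightarrow> (dc_gen word set \<Rightarrow> dc_gen word set) \<Rightarrow> bool" where
  "is_dc_aut n r s \<phi> \<longleftrightarrow>
     \<phi> \<in> carrier (AutoGroup (Dc n)) \<and>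
     \<phi> (dc_x n) = dc_x n [^]\<^bsub>Dc n\<^esub> r \<and>
     \<phi> (dc_y n) = dc_y n \<otimes>\<^bsub>Dc n\<^esub> dc_x n [^]\<^bsub>Dc n\<^esub> s"

end

theory Submission
  imports Defs
begin

text \<open>
  Write \<open>G = Dc n\<close>.  The relation \<open>y\<inverse>xy = x\<inverse>\<close> lets every power of \<open>x\<close> move past \<open>y\<close> with its
  exponent negated, and \<open>y\<inverse> = y x\<^bsup>-n\<^esup>\<close>; so every element is \<open>x\<^bsup>b\<^esup>\<close> or \<open>y x\<^bsup>b\<^esup>\<close>.  The automorphism
  acts on the exponents of these normal forms: \<open>x\<^bsup>b\<^esup> \<mapsto> x\<^bsup>rb\<^esup>\<close> and \<open>y x\<^bsup>b\<^esup> \<mapsto> y x\<^bsup>s + rb\<^esup>\<close>.  Hence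
  \<open>g \<phi>(g)\<inverse>\<close> is \<open>x\<^bsup>b(1 - r)\<^esup>\<close> in the first case, and in the second case
  \<open>y x\<^bsup>b(1 - r) - s\<^esup> y\<inverse> = x\<^bsup>s + b(r - 1)\<^esup>\<close>, which gives \<open>Q\<close>.  Likewise \<open>g\<close> is fixed iff
  \<open>x\<^bsup>b(1 - r)\<^esup> = 1\<close>, respectively \<open>x\<^bsup>b(1 - r)\<^esup> = x\<^bsup>s\<^esup>\<close>.

  To read these equations as congruences, \<open>x\<close> must have order exactly \<open>2n\<close>.  A presentation only
  bounds the order from above; the lower bound (\<open>ord_dc_x\<close>) comes from the two-dimensional complex
  representation in which \<open>x\<close> acts as \<open>diag(\<zeta>, \<zeta>\<inverse>)\<close> for a primitive \<open>2n\<close>-th root of unity \<open>\<zeta>\<close>.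
\<close>

section \<open>Groups whose elements are the normal forms of a dicyclic group\<close>

text \<open>
  The calculation takes place in any group of this shape, where exponents are arbitrary integers.
  Reducing them modulo the order of \<open>x\<close> is a separate matter.
\<close>

locale dicyclic_normal_form = group G for G (structure) +
  fixes x y
  assumes x_closed [simp]: "x \<in> carrier G"
    and y_closed [simp]: "y \<in> carrier G"
    and conj_x: "inv y \<otimes> x \<otimes> y = inv x"
    and carrier_normal_form:
      "carrier G = range (\<lambda>b::int. x [^] b) \<union> range (\<lambda>b::int. y \<otimes> x [^] b)"

lemma (in group) hom_conjugation:
  assumes "h \<in> carrier G"
  shows "(\<lambda>g. inv h \<otimes> g \<otimes> h) \<in> hom G G"
proof (rule homI)
  fix a b assume ab: "a \<in> carrier G" "b \<in> carrier G"
  have "h \<otimes> (inv h \<otimes> (b \<otimes> h)) = b \<otimes> h"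
    using assms ab by (simp flip: m_assoc)
  then show "inv h \<otimes> (a \<otimes> b) \<otimes> h = inv h \<otimes> a \<otimes> h \<otimes> (inv h \<otimes> b \<otimes> h)"
    using assms ab by (simp add: m_assoc)
qed (use assms in simp)

text \<open>Conjugation by \<open>y\<close> is a homomorphism, so it inverts all powers of \<open>x\<close> once it inverts \<open>x\<close>.\<close>

lemma (in group) int_pow_swap:
  fixes b :: int
  assumes [simp]: "x \<in> carrier G" "y \<in> carrier G" and "inv y \<otimes> x \<otimes> y = inv x"
  shows "x [^] b \<otimes> y = y \<otimes> x [^] (- b)"
proof -
  interpret conj: group_hom G G "\<lambda>g. inv y \<otimes> g \<otimes> y"
    by unfold_locales (simp add: hom_conjugation)
  have "inv y \<otimes> (x [^] b) \<otimes> y = x [^] (- b)"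
    using conj.hom_int_pow[of x b] assms by (simp add: int_pow_inv int_pow_neg)
  then have "y \<otimes> x [^] (- b) = y \<otimes> (inv y \<otimes> (x [^] b \<otimes> y))"
    by (simp add: m_assoc)
  also have "\<dots> = x [^] b \<otimes> y"
    by (simp flip: m_assoc)
  finally show ?thesis ..
qed

context dicyclic_normal_form
begin

lemma mult_inv_y_coset:
  fixes b c :: int
  shows "(y \<otimes> x [^] b) \<otimes> inv (y \<otimes> x [^] c) = x [^] (c - b)"
proof -
  have "(y \<otimes> x [^] b) \<otimes> inv (y \<otimes> x [^] c) = y \<otimes> x [^] (- (c - b)) \<otimes> inv y"
    by (simp add: inv_mult_group m_assoc int_pow_diff flip: int_pow_neg)
  also have "\<dots> = x [^] (c - b) \<otimes> y \<otimes> inv y"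
    by (simp only: int_pow_swap[OF x_closed y_closed conj_x])
  also have "\<dots> = x [^] (c - b)"
    by (simp add: m_assoc)
  finally show ?thesis .
qed

context
  fixes \<phi> and r s :: int
  assumes hom: "\<phi> \<in> hom G G"
    and \<phi>_x: "\<phi> x = x [^] r"
    and \<phi>_y: "\<phi> y = y \<otimes> x [^] s"
begin

lemma hom_x_pow: "\<phi> (x [^] b) = x [^] (r * b)" for b :: int
proof -
  interpret \<phi>: group_hom G G \<phi>
    by unfold_locales (rule hom)
  show ?thesis
    by (simp add: \<phi>.hom_int_pow \<phi>_x int_pow_pow)
qed

lemma hom_y_x_pow: "\<phi> (y \<otimes> x [^] b) = y \<otimes> x [^] (s + r * b)" for b :: int
  using hom by (simp add: hom_mult \<phi>_y hom_x_pow m_assoc int_pow_mult)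

lemma displacement_x_pow: "x [^] b \<otimes> inv (\<phi> (x [^] b)) = x [^] (b * (1 - r))" for b :: int
  by (simp add: hom_x_pow algebra_simps flip: int_pow_diff)

lemma displacement_y_x_pow:
  "(y \<otimes> x [^] b) \<otimes> inv (\<phi> (y \<otimes> x [^] b)) = x [^] (s + b * (r - 1))" for b :: int
  by (simp add: hom_y_x_pow mult_inv_y_coset algebra_simps)

lemma displacement_set:
  "{g \<otimes> inv (\<phi> g) | g. g \<in> carrier G} =
     range (\<lambda>b. x [^] (b * (1 - r))) \<union> range (\<lambda>b. x [^] (s + b * (r - 1)))"
  unfolding Setcompr_eq_image Collect_mem_eq
  by (simp only: carrier_normal_form image_Un image_image displacement_x_pow displacement_y_x_pow)

lemma x_pow_fixed_iff:
  "\<phi> (x [^] b) = x [^] b \<longleftrightarrow> [b * (1 - r) = 0] (mod int (ord x))" for b :: int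
  by (simp add: hom_x_pow int_pow_eq cong_iff_dvd_diff algebra_simps)

lemma y_x_pow_fixed_iff:
  "\<phi> (y \<otimes> x [^] b) = y \<otimes> x [^] b \<longleftrightarrow> [b * (1 - r) = s] (mod int (ord x))" for b :: int
  by (simp add: hom_y_x_pow int_pow_eq cong_iff_dvd_diff algebra_simps)

lemma fixed_point_set:
  "{g \<in> carrier G. \<phi> g = g} =
     {x [^] b | b::int. [b * (1 - r) = 0] (mod int (ord x))} \<union>
     {y \<otimes> x [^] b | b::int. [b * (1 - r) = s] (mod int (ord x))}"
  unfolding carrier_normal_form
  by (auto simp: x_pow_fixed_iff y_x_pow_fixed_iff)

end

end

section \<open>Normal forms in the dicyclic group\<close>

context
  fixes n :: nat
begin

interpretation group "Dc n"
  unfolding Dc_def by (rule group_presented_group)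

lemma carrier_Dc: "carrier (Dc n) = range (word_class (dicyclic_rels n))"
  by (simp add: Dc_def carrier_presented_group)

lemma one_Dc: "\<one>\<^bsub>Dc n\<^esub> = word_class (dicyclic_rels n) []"
  by (simp add: Dc_def one_presented_group)

lemma word_class_append_Dc:
  "word_class (dicyclic_rels n) (u @ v) =
     word_class (dicyclic_rels n) u \<otimes>\<^bsub>Dc n\<^esub> word_class (dicyclic_rels n) v"
  by (simp add: Dc_def word_class_mult)

lemma dc_x_closed [simp]: "dc_x n \<in> carrier (Dc n)"
  by (simp add: carrier_Dc dc_x_def)

lemma dc_y_closed [simp]: "dc_y n \<in> carrier (Dc n)"
  by (simp add: carrier_Dc dc_y_def)

lemma word_class_inverse_letter:
  "word_class (dicyclic_rels n) [(a, False)] =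
     inv\<^bsub>Dc n\<^esub> (word_class (dicyclic_rels n) [(a, True)])"
proof (rule inv_equality[symmetric])
  have "word_eq (dicyclic_rels n) [(a, False), (a, True)] []"
    using word_eq.cancel[of _ a False] by simp
  then show "word_class (dicyclic_rels n) [(a, False)] \<otimes>\<^bsub>Dc n\<^esub>
      word_class (dicyclic_rels n) [(a, True)] = \<one>\<^bsub>Dc n\<^esub>"
    by (simp add: one_Dc word_class_eq_iff flip: word_class_append_Dc)
qed (simp_all add: carrier_Dc)

lemma word_class_replicate:
  "word_class (dicyclic_rels n) (replicate k (a, True)) =
     word_class (dicyclic_rels n) [(a, True)] [^]\<^bsub>Dc n\<^esub> k"
proof (induction k)
  case (Suc k)
  have "replicate (Suc k) (a, True) = replicate k (a, True) @ [(a, True)]"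
    by (simp add: replicate_append_same)
  then show ?case
    by (simp only: word_class_append_Dc Suc nat_pow_Suc)
qed (simp add: one_Dc)

lemma word_class_eqI:
  "(u, v) \<in> dicyclic_rels n \<Longrightarrow> word_class (dicyclic_rels n) u = word_class (dicyclic_rels n) v"
  by (simp add: word_class_eq_iff word_eq.rel)

lemma dc_x_pow_2n: "dc_x n [^]\<^bsub>Dc n\<^esub> (2 * n) = \<one>\<^bsub>Dc n\<^esub>"
  using word_class_eqI[of "replicate (2 * n) (gen_x, True)" "[]"]
  unfolding word_class_replicate dc_x_def one_Dc by (simp add: dicyclic_rels_def)

lemma dc_y_square: "dc_y n \<otimes>\<^bsub>Dc n\<^esub> dc_y n = dc_x n [^]\<^bsub>Dc n\<^esub> n"
proof -
  have "dc_y n [^]\<^bsub>Dc n\<^esub> (2::nat) = dc_x n [^]\<^bsub>Dc n\<^esub> n"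
    using word_class_eqI[of "replicate 2 (gen_y, True)" "replicate n (gen_x, True)"]
    unfolding word_class_replicate dc_x_def dc_y_def by (simp add: dicyclic_rels_def)
  then show ?thesis
    by (simp add: numeral_2_eq_2)
qed

lemma dc_conj: "inv\<^bsub>Dc n\<^esub> dc_y n \<otimes>\<^bsub>Dc n\<^esub> dc_x n \<otimes>\<^bsub>Dc n\<^esub> dc_y n = inv\<^bsub>Dc n\<^esub> dc_x n"
proof -
  have "word_class (dicyclic_rels n) ([(gen_y, False)] @ [(gen_x, True)] @ [(gen_y, True)]) =
      word_class (dicyclic_rels n) [(gen_x, False)]"
    by (rule word_class_eqI) (simp add: dicyclic_rels_def)
  then show ?thesis
    unfolding word_class_append_Dc word_class_inverse_letter
    by (simp add: m_assoc flip: dc_x_def dc_y_def)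
qed

lemma inv_dc_y: "inv\<^bsub>Dc n\<^esub> dc_y n = dc_y n \<otimes>\<^bsub>Dc n\<^esub> dc_x n [^]\<^bsub>Dc n\<^esub> (- int n)"
proof (rule inv_equality)
  have "dc_y n \<otimes>\<^bsub>Dc n\<^esub> dc_x n [^]\<^bsub>Dc n\<^esub> (- int n) = dc_x n [^]\<^bsub>Dc n\<^esub> (int n) \<otimes>\<^bsub>Dc n\<^esub> dc_y n"
    by (simp add: int_pow_swap[OF _ _ dc_conj])
  also have "\<dots> \<otimes>\<^bsub>Dc n\<^esub> dc_y n = dc_x n [^]\<^bsub>Dc n\<^esub> n \<otimes>\<^bsub>Dc n\<^esub> dc_x n [^]\<^bsub>Dc n\<^esub> n"
    by (simp add: m_assoc dc_y_square int_pow_int)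
  also have "\<dots> = \<one>\<^bsub>Dc n\<^esub>"
    using dc_x_pow_2n by (simp add: nat_pow_mult mult_2)
  finally show "dc_y n \<otimes>\<^bsub>Dc n\<^esub> dc_x n [^]\<^bsub>Dc n\<^esub> (- int n) \<otimes>\<^bsub>Dc n\<^esub> dc_y n = \<one>\<^bsub>Dc n\<^esub>" .
qed simp_all

text \<open>
  The set of normal forms contains the identity and is closed under right multiplication by powers
  of \<open>x\<close> and by \<open>y\<close>.  Since \<open>y\<inverse> = y x\<^bsup>-n\<^esup>\<close>, it is then closed under right multiplication by every
  letter, and so it contains the class of every word.
\<close>

lemma carrier_Dc_normal_form:
  "carrier (Dc n) = range (\<lambda>b::int. dc_x n [^]\<^bsub>Dc n\<^esub> b) \<union>
     range (\<lambda>b::int. dc_y n \<otimes>\<^bsub>Dc n\<^esub> dc_x n [^]\<^bsub>Dc n\<^esub> b)" (is "_ = ?N")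
proof
  have mult_x: "g \<otimes>\<^bsub>Dc n\<^esub> dc_x n [^]\<^bsub>Dc n\<^esub> c \<in> ?N" if "g \<in> ?N" for g and c :: int
    using that by (auto simp: m_assoc simp flip: int_pow_mult)
  have mult_y: "g \<otimes>\<^bsub>Dc n\<^esub> dc_y n \<in> ?N" if g: "g \<in> ?N" for g
  proof -
    obtain b :: int where "g = dc_x n [^]\<^bsub>Dc n\<^esub> b \<or> g = dc_y n \<otimes>\<^bsub>Dc n\<^esub> dc_x n [^]\<^bsub>Dc n\<^esub> b"
      using g by blast
    then show ?thesis
    proof
      assume "g = dc_x n [^]\<^bsub>Dc n\<^esub> b"
      then show ?thesis
        by (simp add: int_pow_swap[OF _ _ dc_conj])
    next
      assume "g = dc_y n \<otimes>\<^bsub>Dc n\<^esub> dc_x n [^]\<^bsub>Dc n\<^esub> b"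
      then have "g \<otimes>\<^bsub>Dc n\<^esub> dc_y n = dc_y n \<otimes>\<^bsub>Dc n\<^esub> dc_y n \<otimes>\<^bsub>Dc n\<^esub> dc_x n [^]\<^bsub>Dc n\<^esub> (- b)"
        by (simp add: m_assoc int_pow_swap[OF _ _ dc_conj])
      also have "\<dots> = dc_x n [^]\<^bsub>Dc n\<^esub> (int n - b)"
        by (simp add: dc_y_square flip: int_pow_int int_pow_mult)
      finally show ?thesis
        by simp
    qed
  qed
  have mult_letter: "g \<otimes>\<^bsub>Dc n\<^esub> word_class (dicyclic_rels n) [(a, e)] \<in> ?N"
    if g: "g \<in> ?N" for g a e
  proof -
    have [simp]: "g \<in> carrier (Dc n)"
      using g by auto
    show ?thesis
    proof (cases a; cases e)
      assume "a = gen_x" "e"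
      then show ?thesis
        using mult_x[OF g, of 1] by (simp add: dc_x_def[symmetric])
    next
      assume "a = gen_x" "\<not> e"
      then show ?thesis
        using mult_x[OF g, of "- 1"]
        by (simp add: word_class_inverse_letter dc_x_def[symmetric] int_pow_neg)
    next
      assume "a = gen_y" "e"
      then show ?thesis
        using mult_y[OF g] by (simp add: dc_y_def[symmetric])
    next
      assume "a = gen_y" "\<not> e"
      then show ?thesis
        using mult_x[OF mult_y[OF g], of "- int n"]
        by (simp add: word_class_inverse_letter dc_y_def[symmetric] inv_dc_y m_assoc)
    qed
  qed
  have "word_class (dicyclic_rels n) u \<in> ?N" for u
  proof (induction u rule: rev_induct)
    case Nil
    have "word_class (dicyclic_rels n) [] = dc_x n [^]\<^bsub>Dc n\<^esub> (0::int)"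
      by (simp add: one_Dc)
    then show ?case
      by blast
  next
    case (snoc p u)
    then show ?case
      using mult_letter by (cases p) (simp only: word_class_append_Dc)
  qed
  then show "carrier (Dc n) \<subseteq> ?N"
    unfolding carrier_Dc by blast
qed auto

lemma dicyclic_normal_form_Dc: "dicyclic_normal_form (Dc n) (dc_x n) (dc_y n)"
  by unfold_locales (rule dc_x_closed dc_y_closed dc_conj carrier_Dc_normal_form)+

end

section \<open>The order of the cyclic generator\<close>

text \<open>
  The action of words on \<open>\<complex>\<^sup>2\<close> in which \<open>x\<close> is the matrix \<open>diag(z, z\<inverse>)\<close> and \<open>y\<close> is the quarter turn
  \<open>(p, q) \<mapsto> (-q, p)\<close>.  The letters of a word are applied from left to right, so this is a right
  action: \<open>u @ v\<close> acts as \<open>u\<close> followed by \<open>v\<close>.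
\<close>

fun letter_act :: "complex \<Rightarrow> dc_gen \<times> bool \<Rightarrow> complex \<times> complex \<Rightarrow> complex \<times> complex" where
  "letter_act z (gen_x, True) (p, q) = (z * p, q / z)"
| "letter_act z (gen_x, False) (p, q) = (p / z, z * q)"
| "letter_act z (gen_y, True) (p, q) = (- q, p)"
| "letter_act z (gen_y, False) (p, q) = (q, - p)"

definition word_act :: "complex \<Rightarrow> dc_gen word \<Rightarrow> complex \<times> complex \<Rightarrow> complex \<times> complex" where
  "word_act z u = fold (letter_act z) u"

lemma word_act_replicate_x:
  "word_act z (replicate k (gen_x, True)) (p, q) = (z ^ k * p, q / z ^ k)"
  unfolding word_act_def by (induction k arbitrary: p q) (simp_all add: mult_ac)

text \<open>
  The quarter turn \<open>y\<close> squares to \<open>-1\<close>, so the relation \<open>y\<^sup>2 = x\<^sup>n\<close> asks for \<open>z\<^sup>n = -1\<close>; the other two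
  relations then hold automatically.
\<close>

lemma word_act_respects_relations:
  assumes z: "z ^ n = - 1" and "word_eq (dicyclic_rels n) u v"
  shows "word_act z u = word_act z v"
  using assms(2)
proof induction
  case (cancel a e)
  have "z \<noteq> 0"
    using z by (auto simp: power_0_left split: if_splits)
  then show ?case
    by (cases a; cases e) (auto simp: word_act_def)
next
  case (rel u v)
  have "z \<noteq> 0"
    using z by (auto simp: power_0_left split: if_splits)
  have "z ^ (2 * n) = 1"
    using z by (simp add: power_mult power2_eq_square mult.commute[of 2])
  from rel consider "u = replicate (2 * n) (gen_x, True)" "v = []"
    | "u = replicate 2 (gen_y, True)" "v = replicate n (gen_x, True)"
    | "u = [(gen_y, False), (gen_x, True), (gen_y, True)]" "v = [(gen_x, False)]"
    by (auto simp: dicyclic_rels_def)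
  then have "word_act z u (p, q) = word_act z v (p, q)" for p q
  proof cases
    case 1
    then show ?thesis
      using \<open>z ^ (2 * n) = 1\<close> unfolding 1 word_act_replicate_x by (simp add: word_act_def)
  next
    case 2
    then show ?thesis
      using z unfolding 2 word_act_replicate_x by (simp add: word_act_def numeral_2_eq_2)
  next
    case 3
    then show ?thesis
      using \<open>z \<noteq> 0\<close> by (simp add: word_act_def)
  qed
  then show ?case
    by (simp add: fun_eq_iff)
qed (simp_all add: word_act_def)

text \<open>
  This makes \<open>cis (pi / n)\<close> a primitive \<open>2n\<close>-th root of unity: the angle \<open>k pi / n\<close> has to be a whole
  number of full turns.
\<close>

lemma cis_pi_over_pow_eq_1:
  assumes "n > 0" and "cis (pi / real n) ^ k = 1"
  shows "2 * n dvd k"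
proof -
  have "cos (real k * (pi / real n)) = 1"
    using assms(2) by (simp add: DeMoivre complex_eq_iff)
  then obtain m :: int where "real k * (pi / real n) = real_of_int m * 2 * pi"
    by (auto simp: cos_one_2pi_int)
  then have "real k = real_of_int m * 2 * real n"
    using \<open>n > 0\<close> by (simp add: field_simps)
  then have "real_of_int (int k) = real_of_int (m * (2 * int n))"
    by simp
  then have "int k = m * (2 * int n)"
    by (simp only: of_int_eq_iff)
  then have "int (2 * n) dvd int k"
    by simp
  then show ?thesis
    by (simp only: int_dvd_int_iff)
qed

text \<open>
  If \<open>x\<^bsup>k\<^esup> = 1\<close>, then the first coordinate of the action of \<open>x\<^bsup>k\<^esup>\<close> on \<open>(1, 0)\<close> shows that the \<open>k\<close>-th
  power of a primitive \<open>2n\<close>-th root of unity is \<open>1\<close>.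
\<close>

lemma ord_dc_x:
  assumes "n > 0"
  shows "group.ord (Dc n) (dc_x n) = 2 * n"
proof -
  interpret group "Dc n"
    unfolding Dc_def by (rule group_presented_group)
  define z where "z = cis (pi / real n)"
  have z: "z ^ n = - 1"
    using assms by (simp add: z_def DeMoivre)
  have "2 * n dvd k" if "dc_x n [^]\<^bsub>Dc n\<^esub> k = \<one>\<^bsub>Dc n\<^esub>" for k :: nat
  proof -
    have "word_eq (dicyclic_rels n) (replicate k (gen_x, True)) []"
      using that by (simp add: dc_x_def one_Dc word_class_eq_iff flip: word_class_replicate)
    from word_act_respects_relations[OF z this]
    have "word_act z (replicate k (gen_x, True)) (1, 0) = word_act z [] (1, 0)"
      by simp
    then have "z ^ k = 1"
      unfolding word_act_replicate_x by (simp add: word_act_def)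
    then show ?thesis
      unfolding z_def using assms by (rule cis_pi_over_pow_eq_1[rotated])
  qed
  then show ?thesis
    using dc_x_pow_2n by (simp add: dvd_antisym pow_ord_eq_1 pow_eq_id[symmetric])
qed

section \<open>Displacements and fixed points of an automorphism\<close>

text \<open>
  This connects exponents in \<open>residue_ring m\<close> with the integer exponents used so far: \<open>b mod m\<close> is in
  the class of \<open>b\<close>, so restricting \<open>b\<close> to residues loses no value of a function of the class.
\<close>

lemma setcompr_residue_ring:
  fixes f :: "int \<Rightarrow> 'a"
  assumes "m > 1"
    and f: "\<And>a b. [a = b] (mod m) \<Longrightarrow> f a = f b"
    and P: "\<And>a b. [a = b] (mod m) \<Longrightarrow> P a \<longleftrightarrow> P b"
  shows "{f b | b. b \<in> carrier (residue_ring m) \<and> P b} = {f b | b. P b}"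
proof -
  have "\<exists>c. f b = f c \<and> c \<in> carrier (residue_ring m) \<and> P c" if "P b" for b
  proof (intro exI conjI)
    have cong: "[b = b mod m] (mod m)"
      by (simp add: cong_def)
    show "f b = f (b mod m)"
      by (rule f[OF cong])
    show "P (b mod m)"
      using P[OF cong] that by blast
    show "b mod m \<in> carrier (residue_ring m)"
      using \<open>m > 1\<close> by (simp add: residue_ring_def)
  qed
  then have "{f b | b. P b} \<subseteq> {f b | b. b \<in> carrier (residue_ring m) \<and> P b}"
    by (auto simp only: mem_Collect_eq)
  then show ?thesis
    by auto
qed

theorem proposition3p1:
  fixes n k :: nat and r s :: int
    and \<phi> :: "dc_gen word set \<Rightarrow> dc_gen word set"
  assumes "n > 2"
    and "r \<in> Units (residue_ring (2 * int n))" and "s \<in> carrier (residue_ring (2 * int n))"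
    and "is_dc_aut n r s \<phi>"
    and "group.ord (AutoGroup (Dc n)) \<phi> = k"
  shows "({g \<otimes>\<^bsub>Dc n\<^esub> inv\<^bsub>Dc n\<^esub> (\<phi> g) | g. g \<in> carrier (Dc n)} =
           {dc_x n [^]\<^bsub>Dc n\<^esub> (b * (1 - r)) | b. b \<in> carrier (residue_ring (2 * int n))} \<union>
           {dc_x n [^]\<^bsub>Dc n\<^esub> (s + b * (r - 1)) | b. b \<in> carrier (residue_ring (2 * int n))}) \<and>
         ({g \<in> carrier (Dc n). \<phi> g = g} =
           {dc_x n [^]\<^bsub>Dc n\<^esub> b | b. b \<in> carrier (residue_ring (2 * int n)) \<and> [b * (1 - r) = 0] (mod (2 * int n))} \<union>
           {dc_y n \<otimes>\<^bsub>Dc n\<^esub> dc_x n [^]\<^bsub>Dc n\<^esub> b | b.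
              b \<in> carrier (residue_ring (2 * int n)) \<and> [b * (1 - r) = s] (mod (2 * int n))})"
proof -
  interpret D: dicyclic_normal_form "Dc n" "dc_x n" "dc_y n"
    by (rule dicyclic_normal_form_Dc)
  have ord: "int (D.ord (dc_x n)) = 2 * int n"
    using ord_dc_x[of n] \<open>n > 2\<close> by simp
  have hom: "\<phi> \<in> hom (Dc n) (Dc n)" and \<phi>_x: "\<phi> (dc_x n) = dc_x n [^]\<^bsub>Dc n\<^esub> r"
    and \<phi>_y: "\<phi> (dc_y n) = dc_y n \<otimes>\<^bsub>Dc n\<^esub> dc_x n [^]\<^bsub>Dc n\<^esub> s"
    using \<open>is_dc_aut n r s \<phi>\<close> by (simp_all add: is_dc_aut_def AutoGroup_def auto_def)
  have pow_cong: "dc_x n [^]\<^bsub>Dc n\<^esub> a = dc_x n [^]\<^bsub>Dc n\<^esub> b" if "[a = b] (mod 2 * int n)" for a b :: int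
    using that by (simp add: D.int_pow_eq ord cong_iff_dvd_diff dvd_diff_commute)
  have "1 < 2 * int n"
    using \<open>n > 2\<close> by simp
  note reduce = setcompr_residue_ring[OF this]
  have P: "[a * (1 - r) = t] (mod 2 * int n) \<longleftrightarrow> [b * (1 - r) = t] (mod 2 * int n)"
    if "[a = b] (mod 2 * int n)" for a b t
    using cong_scalar_right[OF that, of "1 - r"] by (meson cong_sym cong_trans)
  have reduce_range: "{f b | b. b \<in> carrier (residue_ring (2 * int n))} = range f"
    if "\<And>a b. [a = b] (mod 2 * int n) \<Longrightarrow> f a = f b" for f :: "int \<Rightarrow> dc_gen word set"
    using reduce[of f "\<lambda>_. True", OF that] by (simp add: full_SetCompr_eq)
  have Q: "{dc_x n [^]\<^bsub>Dc n\<^esub> (b * (1 - r)) | b. b \<in> carrier (residue_ring (2 * int n))} =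
      range (\<lambda>b. dc_x n [^]\<^bsub>Dc n\<^esub> (b * (1 - r)))"
    by (intro reduce_range pow_cong cong_scalar_right)
  have Q': "{dc_x n [^]\<^bsub>Dc n\<^esub> (s + b * (r - 1)) | b. b \<in> carrier (residue_ring (2 * int n))} =
      range (\<lambda>b. dc_x n [^]\<^bsub>Dc n\<^esub> (s + b * (r - 1)))"
    by (intro reduce_range pow_cong cong_add cong_refl cong_scalar_right)
  have H: "{dc_x n [^]\<^bsub>Dc n\<^esub> b | b.
        b \<in> carrier (residue_ring (2 * int n)) \<and> [b * (1 - r) = 0] (mod (2 * int n))} =
      {dc_x n [^]\<^bsub>Dc n\<^esub> b | b. [b * (1 - r) = 0] (mod (2 * int n))}"
    "{dc_y n \<otimes>\<^bsub>Dc n\<^esub> dc_x n [^]\<^bsub>Dc n\<^esub> b | b.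
        b \<in> carrier (residue_ring (2 * int n)) \<and> [b * (1 - r) = s] (mod (2 * int n))} =
      {dc_y n \<otimes>\<^bsub>Dc n\<^esub> dc_x n [^]\<^bsub>Dc n\<^esub> b | b. [b * (1 - r) = s] (mod (2 * int n))}"
    by (rule reduce; metis pow_cong P)+
  show ?thesis
    unfolding Q Q' H
    using D.displacement_set[OF hom \<phi>_x \<phi>_y] D.fixed_point_set[OF hom \<phi>_x \<phi>_y]
    unfolding ord by blast
qed

end
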